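(* Let $N$ be a Nijenhuis operator on a $3$-Lie algebra $(\mathfrak g,[\cdot,\cdot,\cdot]_{\mathfrak g})$, let $\mathfrak g_N=(\mathfrak g,[\cdot,\cdot,\cdot]_N)$ be the deformed $3$-Lie algebra, and let $(\mathfrak g;\rho_N)$ be its representation given by $\rho_N(x,y)z=[Nx,Ny,z]_{\mathfrak g}$. Define $\Phi:\wedge^3\mathfrak g_N\to\mathfrak g$ by $$\Phi(x,y,z)=-N\big([Nx,y,z]_{\mathfrak g}+[x,Ny,z]_{\mathfrak g}+[x,y,Nz]_{\mathfrak g}\big)+N^2[x,y,z]_{\mathfrak g},\qquad x,y,z\in\mathfrak g_N.$$ Then $\Phi$ is a $2$-cocycle of $\mathfrak g_N$ with coefficients in $(\mathfrak g;\rho_N)$, and the identity map $\mathrm{Id}:\mathfrak g\to\mathfrak g_N$ is a $\Phi$-twisted Rota-Baxter operator on $\mathfrak g_N$ with respect to the representation $(\mathfrak g;\rho_N)$.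
   Context: All vector spaces are over a fixed field. A 3-Lie algebra is a vector space $\mathfrak g$ with a skew-symmetric trilinear map $[\cdot,\cdot,\cdot]_{\mathfrak g}$ (i.e. a linear map $\wedge^3\mathfrak g\to\mathfrak g$) such that for all $x_1,\dots,x_5\in\mathfrak g$: $[x_1,x_2,[x_3,x_4,x_5]_{\mathfrak g}]_{\mathfrak g}=[[x_1,x_2,x_3]_{\mathfrak g},x_4,x_5]_{\mathfrak g}+[x_3,[x_1,x_2,x_4]_{\mathfrak g},x_5]_{\mathfrak g}+[x_3,x_4,[x_1,x_2,x_5]_{\mathfrak g}]_{\mathfrak g}$. A representation of a 3-Lie algebra $\mathfrak g$ is a pair $(V;\rho)$ with $V$ a vector space and $\rho:\wedge^2\mathfrak g\to\mathfrak{gl}(V)$ linear such that for all $x_1,\dots,x_4\in\mathfrak g$: (i) $[\rho(x_1,x_2),\rho(x_3,x_4)]=\rho([x_1,x_2,x_3]_{\mathfrak g},x_4)+\rho(x_3,[x_1,x_2,x_4]_{\mathfrak g})$ (commutator on the left); (ii) $\rho([x_1,x_2,x_3]_{\mathfrak g},x_4)=\rho(x_1,x_2)\rho(x_3,x_4)+\rho(x_2,x_3)\rho(x_1,x_4)+\rho(x_3,x_1)\rho(x_2,x_4)$. A 2-cocycle on a 3-Lie algebra $\mathfrak g$ with coefficients in a representation $(V;\rho)$ is a linear map $\Phi:\wedge^3\mathfrak g\to V$ such that for all $x_1,\dots,x_5\in\mathfrak g$: $\Phi(x_1,x_2,[x_3,x_4,x_5]_{\mathfrak g})-\Phi([x_1,x_2,x_3]_{\mathfrak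 g},x_4,x_5)-\Phi(x_3,[x_1,x_2,x_4]_{\mathfrak g},x_5)-\Phi(x_3,x_4,[x_1,x_2,x_5]_{\mathfrak g})+\rho(x_1,x_2)\Phi(x_3,x_4,x_5)-\rho(x_3,x_4)\Phi(x_1,x_2,x_5)-\rho(x_4,x_5)\Phi(x_1,x_2,x_3)-\rho(x_5,x_3)\Phi(x_1,x_2,x_4)=0$. For a 2-cocycle $\Phi$, a $\Phi$-twisted Rota-Baxter operator on $\mathfrak g$ with respect to $(V;\rho)$ is a linear map $T:V\to\mathfrak g$ with $[Tu,Tv,Tw]_{\mathfrak g}=T\big(\rho(Tu,Tv)w+\rho(Tv,Tw)u+\rho(Tw,Tu)v+\Phi(Tu,Tv,Tw)\big)$ for all $u,v,w\in V$. For a linear map $N:\mathfrak g\to\mathfrak g$ put $[x,y,z]_N=[Nx,Ny,z]_{\mathfrak g}+[x,Ny,Nz]_{\mathfrak g}+[Nx,y,Nz]_{\mathfrak g}-N[Nx,y,z]_{\mathfrak g}-N[x,Ny,z]_{\mathfrak g}-N[x,y,Nz]_{\mathfrak g}+N^2[x,y,z]_{\mathfrak g}$. $N$ is a Nijenhuis operator if $[Nx,Ny,Nz]_{\mathfrak g}=N([x,y,z]_N)$ for all $x,y,z\in\mathfrak g$. It is known that in this case $\mathfrak g_N:=(\mathfrak g,[\cdot,\cdot,\cdot]_N)$ is a 3-Lie algebra, called the deformed 3-Lie algebra. *)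

theory Defs
  imports HOL.Vector_Spaces
begin

text \<open>
  The ground field is \<open>'k\<close>, of arbitrary characteristic. A vector space over it is a type of class
  \<^class>\<open>ab_group_add\<close> with an explicit scalar multiplication satisfying \<^locale>\<open>vector_space\<close>.

  A linear map out of the exterior square or cube is an alternating multilinear map: it vanishes
  when two arguments coincide. This implies skew-symmetry, and is equivalent to it unless the
  characteristic is 2.
\<close>

definition alternating_bilinear ::
    "('k::field \<Rightarrow> 'a::ab_group_add \<Rightarrow> 'a) \<Rightarrow> ('k \<Rightarrow> 'b::ab_group_add \<Rightarrow> 'b) \<Rightarrow> ('a \<Rightarrow> 'a \<Rightarrow> 'b) \<Rightarrow> bool"
  where "alternating_bilinear s t f \<longleftrightarrow>
    (\<forall>y. Vector_Spaces.linear s t (\<lambda>x. f x y)) \<and>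
    (\<forall>x. Vector_Spaces.linear s t (\<lambda>y. f x y)) \<and>
    (\<forall>x. f x x = 0)"

definition alternating_trilinear ::
    "('k::field \<Rightarrow> 'a::ab_group_add \<Rightarrow> 'a) \<Rightarrow> ('k \<Rightarrow> 'b::ab_group_add \<Rightarrow> 'b) \<Rightarrow> ('a \<Rightarrow> 'a \<Rightarrow> 'a \<Rightarrow> 'b) \<Rightarrow> bool"
  where "alternating_trilinear s t f \<longleftrightarrow>
    (\<forall>y z. Vector_Spaces.linear s t (\<lambda>x. f x y z)) \<and>
    (\<forall>x z. Vector_Spaces.linear s t (\<lambda>y. f x y z)) \<and>
    (\<forall>x y. Vector_Spaces.linear s t (\<lambda>z. f x y z)) \<and>
    (\<forall>x z. f x x z = 0) \<and> (\<forall>x y. f x y x = 0) \<and> (\<forall>x y. f x y y = 0)"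

locale three_Lie_algebra = G: vector_space scale
  for scale :: "'k::field \<Rightarrow> 'g::ab_group_add \<Rightarrow> 'g" +
  fixes br :: "'g \<Rightarrow> 'g \<Rightarrow> 'g \<Rightarrow> 'g"
  assumes bracket_alternating: "alternating_trilinear scale scale br"
    and fundamental_identity:
      "br x1 x2 (br x3 x4 x5) =
        br (br x1 x2 x3) x4 x5 + br x3 (br x1 x2 x4) x5 + br x3 x4 (br x1 x2 x5)"

text \<open>
  The two compatibility conditions below are identities in \<open>gl(V)\<close>, evaluated at an
  arbitrary vector \<open>v\<close>. Bilinearity of \<open>\<rho>\<close> into \<open>gl(V)\<close> is likewise stated pointwise in \<open>v\<close>.
\<close>

locale three_Lie_representation =
  three_Lie_algebra scale br + V: vector_space scaleV
  for scale :: "'k::field \<Rightarrow> 'g::ab_group_add \<Rightarrow> 'g"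
    and br :: "'g \<Rightarrow> 'g \<Rightarrow> 'g \<Rightarrow> 'g"
    and scaleV :: "'k \<Rightarrow> 'v::ab_group_add \<Rightarrow> 'v" +
  fixes \<rho> :: "'g \<Rightarrow> 'g \<Rightarrow> 'v \<Rightarrow> 'v"
  assumes rho_endomorphism: "Vector_Spaces.linear scaleV scaleV (\<rho> x y)"
    and rho_alternating: "alternating_bilinear scale scaleV (\<lambda>x y. \<rho> x y v)"
    and rho_commutator:
      "\<rho> x1 x2 (\<rho> x3 x4 v) - \<rho> x3 x4 (\<rho> x1 x2 v) =
        \<rho> (br x1 x2 x3) x4 v + \<rho> x3 (br x1 x2 x4) v"
    and rho_bracket:
      "\<rho> (br x1 x2 x3) x4 v =
        \<rho> x1 x2 (\<rho> x3 x4 v) + \<rho> x2 x3 (\<rho> x1 x4 v) + \<rho> x3 x1 (\<rho> x2 x4 v)"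

locale three_Lie_2_cocycle = three_Lie_representation scale br scaleV \<rho>
  for scale :: "'k::field \<Rightarrow> 'g::ab_group_add \<Rightarrow> 'g"
    and br :: "'g \<Rightarrow> 'g \<Rightarrow> 'g \<Rightarrow> 'g"
    and scaleV :: "'k \<Rightarrow> 'v::ab_group_add \<Rightarrow> 'v"
    and \<rho> :: "'g \<Rightarrow> 'g \<Rightarrow> 'v \<Rightarrow> 'v" +
  fixes \<Phi> :: "'g \<Rightarrow> 'g \<Rightarrow> 'g \<Rightarrow> 'v"
  assumes cocycle_alternating: "alternating_trilinear scale scaleV \<Phi>"
    and cocycle_identity:
      "\<Phi> x1 x2 (br x3 x4 x5) - \<Phi> (br x1 x2 x3) x4 x5
        - \<Phi> x3 (br x1 x2 x4) x5 - \<Phi> x3 x4 (br x1 x2 x5)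
        + \<rho> x1 x2 (\<Phi> x3 x4 x5) - \<rho> x3 x4 (\<Phi> x1 x2 x5)
        - \<rho> x4 x5 (\<Phi> x1 x2 x3) - \<rho> x5 x3 (\<Phi> x1 x2 x4) = 0"

locale twisted_Rota_Baxter_operator = three_Lie_2_cocycle scale br scaleV \<rho> \<Phi>
  for scale :: "'k::field \<Rightarrow> 'g::ab_group_add \<Rightarrow> 'g"
    and br :: "'g \<Rightarrow> 'g \<Rightarrow> 'g \<Rightarrow> 'g"
    and scaleV :: "'k \<Rightarrow> 'v::ab_group_add \<Rightarrow> 'v"
    and \<rho> :: "'g \<Rightarrow> 'g \<Rightarrow> 'v \<Rightarrow> 'v"
    and \<Phi> :: "'g \<Rightarrow> 'g \<Rightarrow> 'g \<Rightarrow> 'v" +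
  fixes T :: "'v \<Rightarrow> 'g"
  assumes operator_linear: "Vector_Spaces.linear scaleV scale T"
    and Rota_Baxter_identity:
      "br (T u) (T v) (T w) =
        T (\<rho> (T u) (T v) w + \<rho> (T v) (T w) u + \<rho> (T w) (T u) v + \<Phi> (T u) (T v) (T w))"

definition deformed_bracket ::
    "('g::ab_group_add \<Rightarrow> 'g \<Rightarrow> 'g \<Rightarrow> 'g) \<Rightarrow> ('g \<Rightarrow> 'g) \<Rightarrow> 'g \<Rightarrow> 'g \<Rightarrow> 'g \<Rightarrow> 'g"
  where "deformed_bracket br N x y z =
    br (N x) (N y) z + br x (N y) (N z) + br (N x) y (N z)
    - N (br (N x) y z) - N (br x (N y) z) - N (br x y (N z))
    + N (N (br x y z))"

locale Nijenhuis_operator = three_Lie_algebra scale br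
  for scale :: "'k::field \<Rightarrow> 'g::ab_group_add \<Rightarrow> 'g"
    and br :: "'g \<Rightarrow> 'g \<Rightarrow> 'g \<Rightarrow> 'g" +
  fixes N :: "'g \<Rightarrow> 'g"
  assumes Nijenhuis_linear: "Vector_Spaces.linear scale scale N"
    and Nijenhuis_identity: "br (N x) (N y) (N z) = N (deformed_bracket br N x y z)"

end

theory Submission
  imports Defs
begin

text \<open>
  Over \<open>\<gg>[\<lambda>]\<close> the operator \<open>N + \<lambda>\<close> is again Nijenhuis and is injective, and it is
  a homomorphism from its deformed bracket \<open>D + \<lambda>E + \<lambda>\<^sup>2[\<cdot>,\<cdot>,\<cdot>]\<close> to
  \<open>[\<cdot>,\<cdot>,\<cdot>]\<close>, where \<open>D = [\<cdot>,\<cdot>,\<cdot>]\<^sub>N\<close> and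
  \<open>E(x,y,z) = [Nx,y,z] + [x,Ny,z] + [x,y,Nz] - N[x,y,z]\<close>. Hence that deformed bracket satisfies the
  fundamental identity; this is read off one power of \<open>\<lambda>\<close> at a time, from the top down to
  \<open>\<lambda>\<^sup>0\<close>, so no polynomials are needed. The cocycle identity for \<open>\<Phi>\<close> is the
  difference of the fundamental identity of \<open>D\<close> and the sum of the five fundamental
  identities of \<open>[\<cdot>,\<cdot>,\<cdot>]\<close> in which \<open>N\<close> is applied to all arguments but one.
\<close>

section \<open>Alternating trilinear maps and the fundamental identity\<close>

lemma alternating_trilinear_iff:
  "alternating_trilinear s t f \<longleftrightarrow> vector_space s \<and> vector_space t \<and>
    (\<forall>x x' y z. f (x + x') y z = f x y z + f x' y z) \<and>
    (\<forall>x y y' z. f x (y + y') z = f x y z + f x y' z) \<and>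
    (\<forall>x y z z'. f x y (z + z') = f x y z + f x y z') \<and>
    (\<forall>k x y z. f (s k x) y z = t k (f x y z)) \<and>
    (\<forall>k x y z. f x (s k y) z = t k (f x y z)) \<and>
    (\<forall>k x y z. f x y (s k z) = t k (f x y z)) \<and>
    (\<forall>x z. f x x z = 0) \<and> (\<forall>x y. f x y x = 0) \<and> (\<forall>x y. f x y y = 0)"
  by (auto simp: alternating_trilinear_def Vector_Spaces.linear_iff)

lemma alternating_trilinear_swap:
  assumes "alternating_trilinear s t f"
  shows "f y x z = - f x y z" and "f x z y = - f x y z" and "f z y x = - f x y z"
proof -
  note f = assms[unfolded alternating_trilinear_iff]
  have add: "f (x + x') y z = f x y z + f x' y z" "f x (y + y') z = f x y z + f x y' z"
    "f x y (z + z') = f x y z + f x y z'" for x x' y y' z z'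
    using f by simp_all
  have zero: "f x x z = 0" "f x y x = 0" "f x y y = 0" for x y z
    using f by simp_all
  \<comment> \<open>Polarization: the two terms with repeated arguments vanish in each
    expansion.\<close>
  have "f y x z + f x y z = f (x + y) (x + y) z" "f x z y + f x y z = f x (y + z) (y + z)"
    "f z y x + f x y z = f (x + z) y (x + z)"
    by (simp_all only: add) (simp_all add: zero)
  then show "f y x z = - f x y z" "f x z y = - f x y z" "f z y x = - f x y z"
    by (simp_all add: zero eq_neg_iff_add_eq_0)
qed

lemma alternating_trilinear_rotate:
  assumes "alternating_trilinear s t f"
  shows "f y z x = f x y z"
  using alternating_trilinear_swap[OF assms] by metis

text \<open>The defect of the fundamental identity for \<open>t a b c d e = [a,b,[c,d,e]]\<close>, each inner bracket
  being rotated into the last position.\<close>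

definition jacobiator ::
    "('a \<Rightarrow> 'a \<Rightarrow> 'a \<Rightarrow> 'a \<Rightarrow> 'a \<Rightarrow> 'b::ab_group_add) \<Rightarrow> 'a \<Rightarrow> 'a \<Rightarrow> 'a \<Rightarrow> 'a \<Rightarrow> 'a \<Rightarrow> 'b"
  where "jacobiator t a b c d e = t a b c d e - t d e a b c - t e c a b d - t c d a b e"

context three_Lie_algebra
begin

lemmas br_swap = alternating_trilinear_swap[OF bracket_alternating]
lemmas br_rotate = alternating_trilinear_rotate[OF bracket_alternating]

lemma br_linear [simp]:
  "br (x + x') y z = br x y z + br x' y z"
  "br x (y + y') z = br x y z + br x y' z"
  "br x y (z + z') = br x y z + br x y z'"
  "br (scale k x) y z = scale k (br x y z)"
  "br x (scale k y) z = scale k (br x y z)"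
  "br x y (scale k z) = scale k (br x y z)"
  "br x x z = 0" "br x y x = 0" "br x y y = 0"
  using bracket_alternating by (auto simp: alternating_trilinear_iff)

lemma br_diff [simp]: "br x y (z - z') = br x y z - br x y z'"
  by (metis add_diff_cancel br_linear(3) diff_add_cancel)

lemma fundamental_identity_rotated:
  "br a b (br c d e) = br d e (br a b c) + br e c (br a b d) + br c d (br a b e)"
  by (metis fundamental_identity br_rotate)

end

section \<open>Nijenhuis operators and coefficients of the iterated deformed bracket\<close>

context Nijenhuis_operator
begin

lemma N_linear [simp]:
  "N (x + y) = N x + N y" "N (scale k x) = scale k (N x)"
  using Nijenhuis_linear by (auto simp: Vector_Spaces.linear_iff)

lemma N_0 [simp]: "N 0 = 0"
  by (metis N_linear(1) add_cancel_right_right)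

lemma N_uminus [simp]: "N (- x) = - N x"
  by (metis N_0 N_linear(1) add.right_inverse minus_unique)

lemma N_diff [simp]: "N (x - y) = N x - N y"
  by (metis add_diff_cancel N_linear(1) diff_add_cancel)

abbreviation D where "D \<equiv> deformed_bracket br N"

definition E where
  "E x y z = br (N x) y z + br x (N y) z + br x y (N z) - N (br x y z)"

lemma N_D: "N (D x y z) = br (N x) (N y) (N z)"
  by (simp add: Nijenhuis_identity)

lemma D_eq: "D x y z = br (N x) (N y) z + br x (N y) (N z) + br (N x) y (N z) - N (E x y z)"
  by (simp add: deformed_bracket_def E_def algebra_simps)

text \<open>When two arguments coincide, the terms with \<open>N\<close> on exactly one of them
  cancel in pairs by a swap; each other term vanishes by itself.\<close>

lemma D_alternating: "alternating_trilinear scale scale D"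
  using br_swap(1)[of "N x" x for x] br_swap(2)[of _ "N x" x for x] br_swap(3)[of "N x" _ x for x]
  by (auto simp: alternating_trilinear_iff deformed_bracket_def G.vector_space_axioms algebra_simps)

text \<open>\<open>nested i\<close> is the coefficient of \<open>\<lambda>\<^sup>i\<close> in the iterated deformed bracket over
  \<open>\<gg>[\<lambda>]\<close>; \<open>total k\<close> is the part of \<open>[(N+1)a,(N+1)b,[(N+1)c,(N+1)d,(N+1)e]]\<close> of degree
  \<open>k\<close> in \<open>N\<close>.\<close>

definition "nested3 a b c d e = E a b (br c d e) + br a b (E c d e)"
definition "nested2 a b c d e = D a b (br c d e) + E a b (E c d e) + br a b (D c d e)"
definition "nested1 a b c d e = D a b (E c d e) + E a b (D c d e)"
definition "nested0 a b c d e = D a b (D c d e)"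

definition "total1 a b c d e =
  br (N a) b (br c d e) + br a (N b) (br c d e) +
  br a b (br (N c) d e) + br a b (br c (N d) e) + br a b (br c d (N e))"
definition "total2 a b c d e =
  br (N a) (N b) (br c d e) +
  br (N a) b (br (N c) d e) + br (N a) b (br c (N d) e) + br (N a) b (br c d (N e)) +
  br a (N b) (br (N c) d e) + br a (N b) (br c (N d) e) + br a (N b) (br c d (N e)) +
  br a b (br (N c) (N d) e) + br a b (br (N c) d (N e)) + br a b (br c (N d) (N e))"
definition "total3 a b c d e =
  br (N a) (N b) (br (N c) d e) + br (N a) (N b) (br c (N d) e) + br (N a) (N b) (br c d (N e)) +
  br (N a) b (br (N c) (N d) e) + br (N a) b (br (N c) d (N e)) + br (N a) b (br c (N d) (N e)) +
  br a (N b) (br (N c) (N d) e) + br a (N b) (br (N c) d (N e)) + br a (N b) (br c (N d) (N e)) +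
  br a b (br (N c) (N d) (N e))"
definition "total4 a b c d e =
  br a (N b) (br (N c) (N d) (N e)) + br (N a) b (br (N c) (N d) (N e)) +
  br (N a) (N b) (br c (N d) (N e)) + br (N a) (N b) (br (N c) d (N e)) +
  br (N a) (N b) (br (N c) (N d) e)"

text \<open>Coefficient of \<open>\<lambda>\<^sup>4\<close> in the homomorphism property of
  \<open>N + \<lambda>\<close> for the iterated bracket; the next three lemmas compare the
  coefficients of \<open>\<lambda>\<^sup>3\<close>, \<open>\<lambda>\<^sup>2\<close> and
  \<open>\<lambda>\<close>.\<close>

lemma nested3_eq: "nested3 a b c d e = total1 a b c d e - N (br a b (br c d e))"
  by (simp add: nested3_def total1_def E_def algebra_simps)

lemma nested2_eq: "nested2 a b c d e = total2 a b c d e - N (nested3 a b c d e)"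
proof -
  have "nested2 a b c d e + N (nested3 a b c d e) = total2 a b c d e"
    by (simp add: nested2_def nested3_def total2_def D_eq E_def algebra_simps)
  then show ?thesis by (simp add: eq_diff_eq)
qed

lemma nested1_eq: "nested1 a b c d e = total3 a b c d e - N (nested2 a b c d e)"
proof -
  \<comment> \<open>Only the outer brackets are expanded here; grouped this way, each inner sum is a
    sum of brackets with no outer \<open>N\<close>.\<close>
  have "nested1 a b c d e + N (nested2 a b c d e) =
      br (N a) (N b) (E c d e + N (br c d e)) + br a (N b) (D c d e + N (E c d e)) +
      br (N a) b (D c d e + N (E c d e)) + br a b (N (D c d e))"
    by (simp add: nested1_def nested2_def N_D)
       (simp add: D_eq[of a b] E_def[of a b] N_D algebra_simps)
  also have "\<dots> = total3 a b c d e"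
    by (simp add: N_D) (simp add: D_eq E_def total3_def algebra_simps)
  finally show ?thesis by (simp add: eq_diff_eq)
qed

lemma nested0_eq: "nested0 a b c d e = total4 a b c d e - N (nested1 a b c d e)"
proof -
  have "nested0 a b c d e + N (nested1 a b c d e) =
      br (N a) (N b) (D c d e + N (E c d e)) + br a (N b) (N (D c d e)) + br (N a) b (N (D c d e))"
    by (simp add: nested0_def nested1_def N_D) (simp add: D_eq[of a b] N_D algebra_simps)
  also have "\<dots> = total4 a b c d e"
    by (simp add: N_D) (simp add: D_eq total4_def algebra_simps)
  finally show ?thesis by (simp add: eq_diff_eq)
qed

text \<open>Each total runs over all choices of the arguments that receive \<open>N\<close>, so its
  defect is a sum of defects of the original bracket, one per choice.\<close>

lemma jacobiator_total:
  "jacobiator total1 a b c d e = 0" "jacobiator total2 a b c d e = 0"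
  "jacobiator total3 a b c d e = 0" "jacobiator total4 a b c d e = 0"
proof -
  show "jacobiator total1 a b c d e = 0"
    by (simp add: jacobiator_def total1_def algebra_simps
      fundamental_identity_rotated[of "N a" b c d e]
      fundamental_identity_rotated[of a "N b" c d e]
      fundamental_identity_rotated[of a b "N c" d e]
      fundamental_identity_rotated[of a b c "N d" e]
      fundamental_identity_rotated[of a b c d "N e"])
  show "jacobiator total2 a b c d e = 0"
    by (simp add: jacobiator_def total2_def algebra_simps
      fundamental_identity_rotated[of "N a" "N b" c d e]
      fundamental_identity_rotated[of "N a" b "N c" d e]
      fundamental_identity_rotated[of "N a" b c "N d" e]
      fundamental_identity_rotated[of "N a" b c d "N e"]
      fundamental_identity_rotated[of a "N b" "N c" d e]
      fundamental_identity_rotated[of a "N b" c "N d" e]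
      fundamental_identity_rotated[of a "N b" c d "N e"]
      fundamental_identity_rotated[of a b "N c" "N d" e]
      fundamental_identity_rotated[of a b "N c" d "N e"]
      fundamental_identity_rotated[of a b c "N d" "N e"])
  show "jacobiator total3 a b c d e = 0"
    by (simp add: jacobiator_def total3_def algebra_simps
      fundamental_identity_rotated[of "N a" "N b" "N c" d e]
      fundamental_identity_rotated[of "N a" "N b" c "N d" e]
      fundamental_identity_rotated[of "N a" "N b" c d "N e"]
      fundamental_identity_rotated[of "N a" b "N c" "N d" e]
      fundamental_identity_rotated[of "N a" b "N c" d "N e"]
      fundamental_identity_rotated[of "N a" b c "N d" "N e"]
      fundamental_identity_rotated[of a "N b" "N c" "N d" e]
      fundamental_identity_rotated[of a "N b" "N c" d "N e"]
      fundamental_identity_rotated[of a "N b" c "N d" "N e"]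
      fundamental_identity_rotated[of a b "N c" "N d" "N e"])
  show "jacobiator total4 a b c d e = 0"
    by (simp add: jacobiator_def total4_def algebra_simps
      fundamental_identity_rotated[of "N a" "N b" "N c" "N d" e]
      fundamental_identity_rotated[of "N a" "N b" "N c" d "N e"]
      fundamental_identity_rotated[of "N a" "N b" c "N d" "N e"]
      fundamental_identity_rotated[of "N a" b "N c" "N d" "N e"]
      fundamental_identity_rotated[of a "N b" "N c" "N d" "N e"])
qed

text \<open>The defect is additive in the nested map and commutes with the linear map
  \<open>N\<close>.\<close>

lemma jacobiator_diff_N:
  assumes "\<And>a b c d e. t a b c d e = u a b c d e - N (v a b c d e)"
    and "jacobiator u a b c d e = 0" and "jacobiator v a b c d e = 0"
  shows "jacobiator t a b c d e = 0"
proof -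
  have "jacobiator t a b c d e = jacobiator u a b c d e - N (jacobiator v a b c d e)"
    by (simp add: jacobiator_def assms(1) algebra_simps)
  then show ?thesis using assms(2,3) by simp
qed

lemma jacobiator_nested0: "jacobiator nested0 a b c d e = 0"
proof -
  have "jacobiator (\<lambda>a b c d e. br a b (br c d e)) a b c d e = 0"
    using fundamental_identity_rotated[of a b c d e] by (simp add: jacobiator_def)
  then have "jacobiator nested3 a b c d e = 0"
    by (rule jacobiator_diff_N[OF nested3_eq jacobiator_total(1)])
  then have "jacobiator nested2 a b c d e = 0"
    by (rule jacobiator_diff_N[OF nested2_eq jacobiator_total(2)])
  then have "jacobiator nested1 a b c d e = 0"
    by (rule jacobiator_diff_N[OF nested1_eq jacobiator_total(3)])
  then show ?thesis
    by (rule jacobiator_diff_N[OF nested0_eq jacobiator_total(4)])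
qed

section \<open>The deformed algebra and its representation\<close>

lemmas D_rotate = alternating_trilinear_rotate[OF D_alternating]

lemma three_Lie_algebra_deformed: "three_Lie_algebra scale D"
proof
  show "alternating_trilinear scale scale D" by (rule D_alternating)
  show "D a b (D c d e) = D (D a b c) d e + D c (D a b d) e + D c d (D a b e)" for a b c d e
    using jacobiator_nested0[of a b c d e] D_rotate[of d e "D a b c"] D_rotate[of c "D a b d" e]
    by (simp add: jacobiator_def nested0_def algebra_simps)
qed

text \<open>By \<open>N_D\<close>, \<open>N\<close> is a homomorphism from \<open>D\<close> to
  \<open>br\<close>, and this is the adjoint representation of \<open>br\<close> on its own space
  pulled back along \<open>N\<close>.\<close>

lemma three_Lie_representation_deformed:
  "three_Lie_representation scale D scale (\<lambda>x y. br (N x) (N y))"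
proof (rule three_Lie_representation.intro[OF three_Lie_algebra_deformed G.vector_space_axioms
        three_Lie_representation_axioms.intro])
  fix x y v x1 x2 x3 x4
  show "Vector_Spaces.linear scale scale (br (N x) (N y))"
    by (simp add: Vector_Spaces.linear_iff G.vector_space_axioms)
  show "alternating_bilinear scale scale (\<lambda>x y. br (N x) (N y) v)"
    by (simp add: alternating_bilinear_def Vector_Spaces.linear_iff G.vector_space_axioms)
  show "br (N x1) (N x2) (br (N x3) (N x4) v) - br (N x3) (N x4) (br (N x1) (N x2) v) =
      br (N (D x1 x2 x3)) (N x4) v + br (N x3) (N (D x1 x2 x4)) v"
    by (simp add: N_D fundamental_identity[of "N x1" "N x2" "N x3"])
  show "br (N (D x1 x2 x3)) (N x4) v = br (N x1) (N x2) (br (N x3) (N x4) v) +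
      br (N x2) (N x3) (br (N x1) (N x4) v) + br (N x3) (N x1) (br (N x2) (N x4) v)"
    \<comment> \<open>Here the pair \<open>N x4\<close>, \<open>v\<close> acts as a derivation on
      the bracket of the other three.\<close>
    using fundamental_identity_rotated[of "N x4" v "N x1" "N x2" "N x3"]
    by (simp add: N_D br_rotate[of "N x4" v] algebra_simps)
qed

section \<open>The cocycle and the Rota-Baxter identity\<close>

definition twist where
  "twist x y z = - N (br (N x) y z + br x (N y) z + br x y (N z)) + N (N (br x y z))"

text \<open>Up to rotation the subtracted terms are the three action terms of the Rota-Baxter
  identity for the identity map.\<close>

lemma twist_eq:
  "twist x y z = D x y z - (br (N x) (N y) z + br x (N y) (N z) + br (N x) y (N z))"
  by (simp add: twist_def deformed_bracket_def algebra_simps)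

lemma twist_alternating: "alternating_trilinear scale scale twist"
  using br_swap(1)[of "N x" x for x] br_swap(2)[of _ "N x" x for x] br_swap(3)[of "N x" _ x for x]
  by (auto simp: alternating_trilinear_iff twist_def G.vector_space_axioms algebra_simps)

lemmas twist_rotate = alternating_trilinear_rotate[OF twist_alternating]

lemma three_Lie_2_cocycle_twist:
  "three_Lie_2_cocycle scale D scale (\<lambda>x y. br (N x) (N y)) twist"
proof -
  interpret three_Lie_representation scale D scale "\<lambda>x y. br (N x) (N y)"
    by (rule three_Lie_representation_deformed)
  show ?thesis
  proof
    show "alternating_trilinear scale scale twist" by (rule twist_alternating)
    fix a b c d e
    \<comment> \<open>The eight terms of the cocycle identity form four such pairs. In each pair
      \<open>br (N a) (N b) (D c d e)\<close> cancels, and \<open>N_D\<close> turns what remains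
      into \<open>total4\<close>.\<close>
    have "twist a b (D c d e) + br (N a) (N b) (twist c d e) =
        nested0 a b c d e - total4 a b c d e" for a b c d e
      by (simp add: twist_eq N_D nested0_def total4_def algebra_simps)
    then have "jacobiator (\<lambda>a b c d e. twist a b (D c d e) + br (N a) (N b) (twist c d e)) a b c d e
        = jacobiator nested0 a b c d e - jacobiator total4 a b c d e"
      by (simp add: jacobiator_def)
    also have "\<dots> = 0"
      by (simp add: jacobiator_nested0 jacobiator_total)
    finally show "twist a b (D c d e) - twist (D a b c) d e - twist c (D a b d) e
        - twist c d (D a b e) + br (N a) (N b) (twist c d e) - br (N c) (N d) (twist a b e)
        - br (N d) (N e) (twist a b c) - br (N e) (N c) (twist a b d) = 0"
      using twist_rotate[of d e "D a b c"] twist_rotate[of c "D a b d" e]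
      by (simp add: jacobiator_def algebra_simps)
  qed
qed

end

theorem theorem4p2:
  fixes scale :: "'k::field \<Rightarrow> 'g::ab_group_add \<Rightarrow> 'g"
    and br :: "'g \<Rightarrow> 'g \<Rightarrow> 'g \<Rightarrow> 'g"
    and N :: "'g \<Rightarrow> 'g"
    and \<rho>N :: "'g \<Rightarrow> 'g \<Rightarrow> 'g \<Rightarrow> 'g"
    and \<Phi> :: "'g \<Rightarrow> 'g \<Rightarrow> 'g \<Rightarrow> 'g"
  assumes "three_Lie_algebra scale br"
    and "Nijenhuis_operator scale br N"
    and "\<And>x y z. \<rho>N x y z = br (N x) (N y) z"
    and "\<And>x y z. \<Phi> x y z =
      - N (br (N x) y z + br x (N y) z + br x y (N z)) + N (N (br x y z))"
  shows "three_Lie_2_cocycle scale (deformed_bracket br N) scale \<rho>N \<Phi> \<and>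
    twisted_Rota_Baxter_operator scale (deformed_bracket br N) scale \<rho>N \<Phi> id"
proof -
  interpret Nijenhuis_operator scale br N by (rule assms(2))
  have \<rho>N: "\<rho>N = (\<lambda>x y. br (N x) (N y))" and \<Phi>: "\<Phi> = twist"
    by (simp_all add: fun_eq_iff assms(3,4) twist_def)
  have cocycle: "three_Lie_2_cocycle scale D scale \<rho>N \<Phi>"
    unfolding \<rho>N \<Phi> by (rule three_Lie_2_cocycle_twist)
  have "twisted_Rota_Baxter_operator scale D scale \<rho>N \<Phi> id"
  proof (rule twisted_Rota_Baxter_operator.intro[OF cocycle twisted_Rota_Baxter_operator_axioms.intro])
    show "Vector_Spaces.linear scale scale id"
      by (simp add: Vector_Spaces.linear_iff G.vector_space_axioms)
    show "D (id u) (id v) (id w) =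
        id (\<rho>N (id u) (id v) w + \<rho>N (id v) (id w) u + \<rho>N (id w) (id u) v + \<Phi> (id u) (id v) (id w))"
      for u v w
      \<comment> \<open>Two of the three action terms must be rotated to match
        \<open>twist_eq\<close>.\<close>
      using br_rotate[of "N v" "N w" u] br_rotate[of "N u" v "N w"]
      by (simp add: \<rho>N \<Phi> twist_eq algebra_simps)
  qed
  with cocycle show ?thesis by simp
qed

end
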